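(* Let $P\subseteq\mathbb{R}^d$ be a rational $d$-polytope with codenominator $r$. If $\mathbf{0}\in P^\circ$, then $P$ is $r$-rational Gorenstein with Gorenstein point $(1,0,\dots,0)$, and $\operatorname{h}^*_{\mathbb{Q}}(P;t;m)$ is palindromic (for $m\in\mathbb{Z}_{>0}$ such that $\frac mrP$ is a lattice polytope).
   Context: A rational (resp. lattice) polytope is the convex hull of finitely many points of $\mathbb{Q}^d$ (resp. $\mathbb{Z}^d$); a $d$-polytope is a $d$-dimensional polytope in $\mathbb{R}^d$, $d\ge1$; $P^\circ$ is the interior. Codenominator: write a rational $d$-polytope $P$ by its irredundant halfspace description $P=\{\mathbf{x}\in\mathbb{R}^d:\mathbf{A}\mathbf{x}\le\mathbf{b}\}$ with $\mathbf{A}\in\mathbb{Z}^{n\times d}$, $\mathbf{b}\in\mathbb{Z}^n$, such that for every $i$ the greatest common divisor of $b_i$ and the entries of the $i$th row of $\mathbf{A}$ is $1$; the codenominator of $P$ is the (positive) least common multiple $r$ of the nonzero entries of $\mathbf{b}$. Put $\operatorname{ehr}_{\mathbb{Q}}(P;\lambda)=|\lambda P\cap\mathbb{Z}^d|$ and $\operatorname{Ehr}_{\mathbb{Q}}(P;t)=1+\sum_{n\in\mathbb{Z}_{>0}}\operatorname{ehr}_{\mathbb{Q}}(P;\frac nr)t^{\frac nr}$. For $m\in\mathbb{Z}_{>0}$ with $\frac mrP$ a lattice polytope, $\operatorname{h}^*_{\mathbb{Q}}(P;t;m):=(1-t^{m/r})^{d+1}\operatorname{Ehr}_{\mathbb{Q}}(P;t)$,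 a polynomial in $\mathbb{Z}[t^{1/r}]$. A polynomial $f(t)\in\mathbb{Z}[t^{1/r}]$ of (possibly fractional) degree $\delta$ in $t$ is palindromic if $t^{\delta}f(1/t)=f(t)$. For a rational polytope $Q\subset\mathbb{R}^d$, $\hom(Q)=\operatorname{cone}(\{1\}\times Q)\subset\mathbb{R}^{d+1}$. A $(d+1)$-dimensional pointed rational cone $C\subseteq\mathbb{R}^{d+1}$ is Gorenstein if there is a point $(p_0,\mathbf{p})\in C\cap\mathbb{Z}^{d+1}$ with $C^\circ\cap\mathbb{Z}^{d+1}=(p_0,\mathbf{p})+(C\cap\mathbb{Z}^{d+1})$, called the Gorenstein point. A rational $d$-polytope $P$ is $\gamma$-rational Gorenstein if $\hom(\frac1\gamma P)$ is a Gorenstein cone; its Gorenstein point is that of the cone. *)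

theory Defs
  imports "HOL-Analysis.Analysis" "HOL-Computational_Algebra.Computational_Algebra"
begin

text \<open>
  Everything that does not need coordinates is stated over an arbitrary Euclidean space
  with its standard basis: the ambient \<open>d\<close>-space is \<open>real ^ 'n\<close>, and the \<open>(d+1)\<close>-space
  containing the homogenization is \<open>real \<times> (real ^ 'n)\<close>.
\<close>

definition int_points :: "'a::euclidean_space set" where
  "int_points = {x. \<forall>b\<in>Basis. x \<bullet> b \<in> \<int>}"

definition rat_points :: "'a::euclidean_space set" where
  "rat_points = {x. \<forall>b\<in>Basis. x \<bullet> b \<in> \<rat>}"

definition lattice_polytope :: "'a::euclidean_space set \<Rightarrow> bool" where
  "lattice_polytope P \<longleftrightarrow> (\<exists>V. finite V \<and> V \<subseteq> int_points \<and> P = convex hull V)"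

definition rational_polytope :: "'a::euclidean_space set \<Rightarrow> bool" where
  "rational_polytope P \<longleftrightarrow> (\<exists>V. finite V \<and> V \<subseteq> rat_points \<and> P = convex hull V)"

definition rational_d_polytope :: "'a::euclidean_space set \<Rightarrow> bool" where
  "rational_d_polytope P \<longleftrightarrow> rational_polytope P \<and> aff_dim P = int DIM('a)"

definition dilate :: "real \<Rightarrow> 'a::real_vector set \<Rightarrow> 'a set" where
  "dilate k P = (*\<^sub>R) k ` P"


subsection \<open>Codenominator\<close>

text \<open>
  An integral system \<open>A x \<le> b\<close> is represented by the set of its rows \<open>(a, b\<^sub>i)\<close>. The order
  of the rows is immaterial, and repeated rows are excluded by irredundancy.
\<close>

definition ineq_set :: "(int ^ 'n) \<times> int \<Rightarrow> (real ^ 'n) set" where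
  "ineq_set = (\<lambda>(a, b). {x. (\<Sum>j\<in>UNIV. of_int (a $ j) * x $ j) \<le> of_int b})"

definition halfspace_description :: "((int ^ 'n) \<times> int) set \<Rightarrow> (real ^ 'n) set \<Rightarrow> bool" where
  "halfspace_description H P \<longleftrightarrow>
     finite H \<and> P = (\<Inter>h\<in>H. ineq_set h) \<and>
     (\<forall>h\<in>H. (\<Inter>h'\<in>H - {h}. ineq_set h') \<noteq> P) \<and>
     (\<forall>(a, b)\<in>H. Gcd (insert b (range (($) a))) = 1)"

text \<open>
  For a rational \<open>d\<close>-polytope there is exactly one such \<open>H\<close> (one row per facet), so that the
  codenominator is a function of \<open>P\<close>; it is used as a relation here.
\<close>

definition has_codenominator :: "(real ^ 'n) set \<Rightarrow> nat \<Rightarrow> bool" where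
  "has_codenominator P r \<longleftrightarrow>
     (\<exists>H. halfspace_description H P \<and> int r = Lcm {b \<in> snd ` H. b \<noteq> 0})"


subsection \<open>Rational Ehrhart series\<close>

definition ehrQ :: "'a::euclidean_space set \<Rightarrow> real \<Rightarrow> nat" where
  "ehrQ P k = card (dilate k P \<inter> int_points)"

text \<open>
  Series in \<open>t\<^bsup>1/r\<^esup>\<close> are formal power series, and elements of \<open>\<int>[t\<^bsup>1/r\<^esup>]\<close> polynomials, in an
  indeterminate \<open>X\<close> standing for \<open>t\<^bsup>1/r\<^esup>\<close>; thus \<open>X^n\<close> is \<open>t\<^bsup>n/r\<^esup>\<close>, and a polynomial of degree
  \<open>D\<close> in \<open>X\<close> has degree \<open>D/r\<close> in \<open>t\<close>.
\<close>

definition EhrQ :: "'a::euclidean_space set \<Rightarrow> nat \<Rightarrow> int fps" where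
  "EhrQ P r = Abs_fps (\<lambda>n. if n = 0 then 1 else int (ehrQ P (real n / real r)))"

definition hstarQ :: "'a::euclidean_space set \<Rightarrow> nat \<Rightarrow> nat \<Rightarrow> int fps" where
  "hstarQ P r m = (1 - fps_X ^ m) ^ (DIM('a) + 1) * EhrQ P r"

text \<open>
  With \<open>D = degree f\<close> the condition \<open>t\<^bsup>D/r\<^esup> f(1/t) = f(t)\<close> reads \<open>X^D f(1/X) = f(X)\<close>, and
  \<open>reflect_poly f\<close> is \<open>X^D f(1/X)\<close>.
\<close>

definition palindromic :: "int poly \<Rightarrow> bool" where
  "palindromic f \<longleftrightarrow> reflect_poly f = f"


subsection \<open>Gorenstein cones\<close>

definition homog :: "'a::euclidean_space set \<Rightarrow> (real \<times> 'a) set" where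
  "homog Q = convex_cone hull ({1} \<times> Q)"

definition rational_cone :: "'a::euclidean_space set \<Rightarrow> bool" where
  "rational_cone C \<longleftrightarrow> (\<exists>V. finite V \<and> V \<subseteq> rat_points \<and> C = convex_cone hull V)"

definition pointed_cone :: "'a::real_vector set \<Rightarrow> bool" where
  "pointed_cone C \<longleftrightarrow> C \<inter> uminus ` C = {0}"

definition gorenstein_point :: "'a::euclidean_space set \<Rightarrow> 'a \<Rightarrow> bool" where
  "gorenstein_point C p \<longleftrightarrow>
     p \<in> C \<inter> int_points \<and> interior C \<inter> int_points = (+) p ` (C \<inter> int_points)"

definition gorenstein_cone :: "'a::euclidean_space set \<Rightarrow> bool" where
  "gorenstein_cone C \<longleftrightarrow>
     rational_cone C \<and> pointed_cone C \<and> dim C = DIM('a) \<and> (\<exists>p. gorenstein_point C p)"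

definition rational_gorenstein :: "real \<Rightarrow> 'a::euclidean_space set \<Rightarrow> bool" where
  "rational_gorenstein \<gamma> P \<longleftrightarrow>
     rational_d_polytope P \<and> gorenstein_cone (homog (dilate (1 / \<gamma>) P))"

definition rational_gorenstein_point :: "real \<Rightarrow> 'a::euclidean_space set \<Rightarrow> real \<times> 'a \<Rightarrow> bool" where
  "rational_gorenstein_point \<gamma> P p \<longleftrightarrow> gorenstein_point (homog (dilate (1 / \<gamma>) P)) p"

end

theory Submission
  imports Defs
begin

text \<open>
  Let \<open>P = {x. \<forall>i. a\<^sub>i \<bullet> x \<le> b\<^sub>i}\<close>. Since the origin is interior, every \<open>b\<^sub>i\<close> is positive, so it divides
  \<open>r\<close>, and \<open>t/r \<cdot> P = {x. \<forall>i. (r/b\<^sub>i) a\<^sub>i \<bullet> x \<le> t}\<close> is cut out by integral rows with right-hand sides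
  all equal to \<open>t\<close> (\<open>codenominator_integral_rows\<close>). Hence the cone over \<open>P/r\<close> is
  \<open>{(t, x). 0 \<le> t \<and> (\<forall>i. (r/b\<^sub>i) a\<^sub>i \<bullet> x \<le> t)}\<close>; on lattice points the strict inequalities that describe
  its interior are the weak ones with \<open>t\<close> lowered by one, which is the Gorenstein property with point
  \<open>(1, 0)\<close> (\<open>gorenstein_cone_of_rows\<close>).

  Palindromicity is proved by hand rather than from Ehrhart--Macdonald reciprocity. By the same
  rows, the gauge of \<open>P/r\<close> takes natural number values \<open>N x\<close> on lattice points \<open>x\<close>, and
  \<open>|n/r \<cdot> P \<inter> \<int>\<^sup>d|\<close> is the number of lattice points with \<open>N x \<le> n\<close>. So \<open>(1 - X)\<close> times the Ehrhart series is
  \<open>G = \<Sum>\<^sub>x X\<^bsup>N x\<^esup>\<close>, the sum ranging over the whole lattice, and it suffices that \<open>(1 - X\<^sup>m)\<^sup>d G\<close> is a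
  polynomial whose coefficients are symmetric about \<open>m d / 2\<close> (\<open>level_fps_symmetric\<close>); the
  remaining factor \<open>(1 - X\<^sup>m) / (1 - X) = 1 + X + \<dots> + X\<^bsup>m - 1\<^esup>\<close> of \<open>h\<^sup>*\<close> is palindromic as well.

  For this the space is cut into simplicial cones spanned by \<open>d\<close>-subsets of the lattice points \<open>V\<close>
  with \<open>m/r \<cdot> P = conv V\<close>, on each of which \<open>N\<close> is linear with value \<open>m\<close> on the generators. The cones
  are those of a regular triangulation with heights close to \<open>1\<close>, described through linear
  programming: \<open>B \<subseteq> V\<close> is used when the linear function that agrees with the heights on \<open>B\<close> lies
  strictly below them on the rest of \<open>V\<close>. One simplex pivot shows that these cones cover
  (\<open>regular_cells_cover\<close>), weak duality that their interiors are disjoint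
  (\<open>regular_cells_interior_disjoint\<close>). Moving a point infinitesimally in a generic direction \<open>w\<close>
  assigns it to exactly one cone, so the space is partitioned into half-open cones
  (\<open>half_open_partition\<close>). Multiplying the generating function of a half-open cone by
  \<open>(1 - X\<^sup>m)\<^sup>d\<close> leaves that of its half-open fundamental box (\<open>level_fps_boxes\<close>). Finally the point
  reflection \<open>x \<mapsto> \<Sum>B - x\<close> takes the box for \<open>w\<close> to the box for \<open>-w\<close> and \<open>N\<close> to \<open>m d - N\<close>. As the sum
  over all boxes is the same for \<open>w\<close> and for \<open>-w\<close>, it is symmetric (\<open>box_reflect\<close>).
\<close>

section \<open>Bases and coordinates\<close>

definition basis_set :: "'a::euclidean_space set \<Rightarrow> bool" where
  "basis_set B \<longleftrightarrow> independent B \<and> card B = DIM('a)"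

definition lin_ext :: "'a::euclidean_space set \<Rightarrow> ('a \<Rightarrow> real) \<Rightarrow> 'a \<Rightarrow> real" where
  "lin_ext B h x = (\<Sum>v\<in>B. representation B x v * h v)"

lemma basis_setD:
  fixes B :: "'a::euclidean_space set"
  assumes "basis_set B"
  shows "independent B" "finite B" "x \<in> span B" "card B = DIM('a)"
proof -
  show 1: "independent B" "card B = DIM('a)" using assms by (auto simp: basis_set_def)
  show "finite B" using 1(1) by (rule independent_imp_finite)
  have "UNIV \<subseteq> span B"
    by (rule card_ge_dim_independent) (use 1 in auto)
  then show "x \<in> span B" by auto
qed

lemma coord_sum:
  assumes "basis_set B" shows "(\<Sum>v\<in>B. representation B x v *\<^sub>R v) = x"
  using real_vector.sum_representation_eq[of B x B] basis_setD[OF assms] by auto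

lemma coord_linear:
  assumes "basis_set B"
  shows "representation B (x + y) v = representation B x v + representation B y v"
    and "representation B (x - y) v = representation B x v - representation B y v"
    and "representation B (c *\<^sub>R x) v = c * representation B x v"
    and "representation B (- x) v = - representation B x v"
    and "representation B (\<Sum>i\<in>I. f i) v = (\<Sum>i\<in>I. representation B (f i) v)"
  using basis_setD[OF assms]
  by (simp_all add: real_vector.representation_add real_vector.representation_diff
      real_vector.representation_scale real_vector.representation_neg real_vector.representation_sum)

lemma coord_basis:
  assumes "basis_set B" "b \<in> B"
  shows "representation B b v = (if v = b then 1 else 0)"
  using real_vector.representation_basis[of B b] basis_setD[OF assms(1)] assms(2) by simp

lemma coord_eqI:
  assumes B: "basis_set B" and x: "x = (\<Sum>v\<in>B. c v *\<^sub>R v)" and "v \<in> B"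
  shows "representation B x v = c v"
proof -
  have "representation B x v = (\<Sum>u\<in>B. c u * representation B u v)"
    unfolding x by (simp add: coord_linear[OF B])
  also have "\<dots> = (\<Sum>u\<in>B. if u = v then c u else 0)"
    by (intro sum.cong) (auto simp: coord_basis[OF B])
  also have "\<dots> = c v" using \<open>v \<in> B\<close> basis_setD[OF B] by simp
  finally show ?thesis .
qed

lemma linear_lin_ext: "basis_set B \<Longrightarrow> linear (lin_ext B h)"
  by (rule linearI) (simp_all add: lin_ext_def coord_linear algebra_simps sum.distrib sum_distrib_left)

lemma lin_ext_basis: "basis_set B \<Longrightarrow> b \<in> B \<Longrightarrow> lin_ext B h b = h b"
  by (simp add: lin_ext_def coord_basis if_distrib[of "\<lambda>z. z * _"] basis_setD cong: if_cong)

lemma lin_ext_sum: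
  assumes "basis_set B"
  shows "lin_ext B h (\<Sum>v\<in>S. c v *\<^sub>R v) = (\<Sum>v\<in>S. c v * lin_ext B h v)"
  using linear_lin_ext[OF assms, of h] by (simp add: linear_sum linear_cmul)

text \<open>
  The minimum ratio rule of the simplex method: moving along \<open>- a\<close> from a nonnegative \<open>c\<close> until the
  first coordinate \<open>p\<close> reaches zero keeps every coordinate nonnegative.
\<close>

lemma ratio_test:
  fixes c a :: "'b \<Rightarrow> real"
  assumes "finite S" "v \<in> S" "a v > 0"
  obtains p where "p \<in> S" "a p > 0" "\<And>v. v \<in> S \<Longrightarrow> c v \<ge> 0 \<Longrightarrow> c p \<ge> 0 \<Longrightarrow> c v - c p / a p * a v \<ge> 0"
proof -
  define A where "A = {v\<in>S. a v > 0}"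
  have A: "finite A" "A \<noteq> {}" using assms by (auto simp: A_def)
  obtain p where p: "p \<in> A" "\<And>v. v \<in> A \<Longrightarrow> c p / a p \<le> c v / a v"
    using arg_min_if_finite(1)[OF A, of "\<lambda>v. c v / a v"] arg_min_least[OF A, of _ "\<lambda>v. c v / a v"] by metis
  show thesis
  proof (rule that[of p])
    fix v assume v: "v \<in> S" "c v \<ge> 0" "c p \<ge> 0"
    show "c v - c p / a p * a v \<ge> 0"
    proof (cases "a v > 0")
      case True
      then show ?thesis using p(2)[of v] v by (simp add: A_def pos_le_divide_eq)
    next
      case False
      then have "c p / a p * a v \<le> 0" using p(1) v by (intro mult_nonneg_nonpos divide_nonneg_nonneg) (auto simp: A_def)
      then show ?thesis using v by simp
    qed
  qed (use p in \<open>auto simp: A_def\<close>)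
qed

text \<open>
  As long as the vectors are dependent, subtracting a multiple of a linear relation, chosen by the
  ratio rule, removes one of them from the combination.
\<close>

lemma conic_caratheodory:
  fixes V :: "'a::real_vector set"
  assumes "finite V" and "y = (\<Sum>v\<in>V. c v *\<^sub>R v)" and "\<And>v. v \<in> V \<Longrightarrow> 0 \<le> c v"
  shows "\<exists>S d. S \<subseteq> V \<and> independent S \<and> y = (\<Sum>v\<in>S. d v *\<^sub>R v) \<and> (\<forall>v\<in>S. 0 \<le> d v)"
  using assms
proof (induction V arbitrary: c rule: finite_psubset_induct)
  case (psubset V)
  show ?case
  proof (cases "independent V")
    case True
    then show ?thesis using psubset.prems by blast
  next
    case False
    then obtain a0 v0 where a0: "(\<Sum>v\<in>V. a0 v *\<^sub>R v) = 0" "v0 \<in> V" "a0 v0 \<noteq> 0"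
      using dependent_finite[OF psubset.hyps] by blast
    (* The ratio rule needs a positive entry. *)
    define a where "a v = a0 v * sgn (a0 v0)" for v
    have "(\<Sum>v\<in>V. a v *\<^sub>R v) = sgn (a0 v0) *\<^sub>R (\<Sum>v\<in>V. a0 v *\<^sub>R v)"
      by (simp add: a_def scaleR_sum_right mult.commute)
    with a0 have a: "(\<Sum>v\<in>V. a v *\<^sub>R v) = 0" "a v0 > 0"
      by (auto simp: a_def zero_less_mult_iff)
    obtain p where p: "p \<in> V" "a p > 0"
      "\<And>v. v \<in> V \<Longrightarrow> c v \<ge> 0 \<Longrightarrow> c p \<ge> 0 \<Longrightarrow> c v - c p / a p * a v \<ge> 0"
      using ratio_test[of V v0 a c] psubset.hyps a0 a by metis
    define d where "d v = c v - c p / a p * a v" for v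
    have "(\<Sum>v\<in>V. d v *\<^sub>R v) = (\<Sum>v\<in>V. c v *\<^sub>R v) - (c p / a p) *\<^sub>R (\<Sum>v\<in>V. a v *\<^sub>R v)"
      by (simp add: d_def scaleR_diff_left sum_subtractf scaleR_sum_right)
    then have "y = (\<Sum>v\<in>V. d v *\<^sub>R v)" using a psubset.prems by simp
    also have "\<dots> = (\<Sum>v\<in>V-{p}. d v *\<^sub>R v)"
      using p psubset.hyps by (subst sum.remove[of V p]) (auto simp: d_def)
    finally have "\<exists>S d. S \<subseteq> V - {p} \<and> independent S \<and> y = (\<Sum>v\<in>S. d v *\<^sub>R v) \<and> (\<forall>v\<in>S. 0 \<le> d v)"
      using p psubset.prems by (intro psubset.IH[of "V - {p}" d]) (auto simp: d_def)
    then show ?thesis by blast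
  qed
qed

text \<open>
  A small positive multiple of \<open>y\<close> lies in the hull.
\<close>

lemma nonneg_combination_of_hull:
  fixes V :: "'a::euclidean_space set"
  assumes V: "finite V" and "0 \<in> interior (convex hull V)"
  shows "\<exists>c. y = (\<Sum>v\<in>V. c v *\<^sub>R v) \<and> (\<forall>v\<in>V. 0 \<le> c v)"
proof -
  obtain e where e: "e > 0" "cball 0 e \<subseteq> convex hull V"
    using assms(2) by (meson mem_interior_cball)
  define k where "k = e / (norm y + 1)"
  have "norm y / (norm y + 1) \<le> 1" by (intro divide_le_eq_1_pos[THEN iffD2]) (auto intro: add_nonneg_pos)
  then have k: "k > 0" "norm (k *\<^sub>R y) \<le> e" using e mult_left_mono[of "norm y / (norm y + 1)" 1 e]
    by (auto simp: k_def add_pos_nonneg add_nonneg_pos)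
  then have "k *\<^sub>R y \<in> convex hull V" using e by auto
  then obtain c where c: "\<forall>v\<in>V. 0 \<le> c v" "(\<Sum>v\<in>V. c v *\<^sub>R v) = k *\<^sub>R y"
    by (auto simp: convex_hull_finite[OF V])
  have "y = (\<Sum>v\<in>V. (c v / k) *\<^sub>R v)"
  proof -
    have "(\<Sum>v\<in>V. (c v / k) *\<^sub>R v) = (1/k) *\<^sub>R (\<Sum>v\<in>V. c v *\<^sub>R v)"
      by (simp add: scaleR_sum_right)
    then show ?thesis using k c by simp
  qed
  then show ?thesis using c k by (intro exI[of _ "\<lambda>v. c v / k"]) auto
qed

section \<open>The cones of a regular triangulation\<close>

text \<open>
  Besides positivity there are two demands on the heights: the expression of a vector of \<open>V\<close> in a
  basis from \<open>V\<close> never holds for the heights by accident, and these are so close to the constant \<open>1\<close> that every strict violation by the constant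
  heights persists. The second one makes the triangulation refine the faces of \<open>conv V\<close>
  (\<open>lin_ext_one_le\<close>).
\<close>

definition generic_heights :: "'a::euclidean_space set \<Rightarrow> ('a \<Rightarrow> real) \<Rightarrow> bool" where
  "generic_heights V h \<longleftrightarrow> (\<forall>v\<in>V. 0 < h v) \<and>
     (\<forall>B u. B \<subseteq> V \<and> basis_set B \<and> u \<in> V - B \<longrightarrow>
        lin_ext B h u \<noteq> h u \<and> (1 < lin_ext B (\<lambda>_. 1) u \<longrightarrow> h u < lin_ext B h u))"

text \<open>
  Heights \<open>1 + e\<^bsup>i\<^esup>\<close> with a different exponent \<open>i\<close> for each vector work for small \<open>e > 0\<close>. The difference
  of the two sides is a polynomial in \<open>e\<close> which is nonzero, because the exponent of \<open>u\<close> occurs only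
  once, and which at \<open>e = 0\<close> has the value given by the constant heights.
\<close>

lemma generic_heights_exist:
  fixes V :: "'a::euclidean_space set"
  assumes V: "finite V"
  shows "\<exists>h. generic_heights V h"
proof -
  obtain i :: "'a \<Rightarrow> nat" where i: "inj_on i V"
    using finite_imp_inj_to_nat_seg[OF V] by blast
  define h where "h e v = 1 + e ^ Suc (i v)" for e :: real and v
  have ev: "eventually (\<lambda>e. lin_ext B (h e) u \<noteq> h e u \<and>
      (1 < lin_ext B (\<lambda>_. 1) u \<longrightarrow> h e u < lin_ext B (h e) u)) (at_right 0)"
    if B: "B \<subseteq> V" "basis_set B" and u: "u \<in> V - B" for B u
  proof -
    define p where "p = (\<Sum>v\<in>B. smult (representation B u v) (1 + monom 1 (Suc (i v))))
        - 1 - monom 1 (Suc (i u))"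
    have poly_p: "poly p e = lin_ext B (h e) u - h e u" for e
      by (simp add: p_def poly_sum lin_ext_def h_def poly_monom)
    have "coeff p (Suc (i u)) = (\<Sum>v\<in>B. representation B u v * (if i v = i u then 1 else 0)) - 1"
      by (simp add: p_def coeff_sum if_distrib)
    also have "(\<Sum>v\<in>B. representation B u v * (if i v = i u then 1 else 0)) = 0"
      using B u i by (intro sum.neutral) (auto dest: inj_onD)
    finally have "p \<noteq> 0" by auto
    then have "finite {e. poly p e = 0}" by (rule poly_roots_finite)
    then have "eventually (\<lambda>e. e \<notin> {e. poly p e = 0}) (at 0)"
      by (metis islimpt_finite islimpt_iff_eventually)
    then have 1: "eventually (\<lambda>e. lin_ext B (h e) u \<noteq> h e u) (at_right 0)"
      unfolding eventually_at_split by (auto elim!: eventually_mono simp: poly_p)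
    have lim: "((\<lambda>e. lin_ext B (h e) u - h e u) \<longlongrightarrow> poly p 0) (at_right 0)"
      unfolding poly_p[symmetric] by (intro tendsto_intros)
    have 2: "eventually (\<lambda>e. h e u < lin_ext B (h e) u) (at_right 0)" if "1 < lin_ext B (\<lambda>_. 1) u"
    proof -
      have "poly p 0 = lin_ext B (\<lambda>_. 1) u - 1" unfolding poly_p by (simp add: h_def lin_ext_def)
      with that have "0 < poly p 0" by simp
      from order_tendstoD(1)[OF lim this] show ?thesis by simp
    qed
    show ?thesis using 1 2 by (cases "1 < lin_ext B (\<lambda>_. 1) u") (auto elim: eventually_elim2)
  qed
  define I where "I = Sigma {B. B \<subseteq> V \<and> basis_set B} (\<lambda>B. V - B)"
  have "finite I" unfolding I_def using V by auto
  then have "eventually (\<lambda>e. \<forall>Bu\<in>I. (case Bu of (B, u) \<Rightarrow> lin_ext B (h e) u \<noteq> h e u \<and>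
      (1 < lin_ext B (\<lambda>_. 1) u \<longrightarrow> h e u < lin_ext B (h e) u))) (at_right 0)"
    by (rule eventually_ball_finite) (auto simp: I_def intro: ev)
  moreover have "eventually (\<lambda>e::real. e > 0) (at_right 0)"
    by (rule eventually_at_right_less)
  ultimately have "eventually (\<lambda>e. generic_heights V (h e)) (at_right 0)"
  proof eventually_elim
    case (elim e)
    have "0 < h e v" for v unfolding h_def using elim by (intro add_pos_pos) auto
    with elim(1) show ?case unfolding generic_heights_def I_def by blast
  qed
  then show ?thesis using eventually_happens' trivial_limit_at_right_real by blast
qed

text \<open>
  The maximal simplices of the regular triangulation induced by \<open>h\<close>. Equivalently, \<open>B\<close> is the unique
  optimal basis of the linear program that minimizes \<open>\<Sum>v\<in>V. c v * h v\<close> over the nonnegative \<open>c\<close>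
  representing a given interior point of the cone over \<open>B\<close>.
\<close>

definition regular_cells :: "'a::euclidean_space set \<Rightarrow> ('a \<Rightarrow> real) \<Rightarrow> 'a set set" where
  "regular_cells V h = {B. B \<subseteq> V \<and> basis_set B \<and> (\<forall>u\<in>V-B. lin_ext B h u < h u)}"

lemma regular_cellsD:
  assumes "B \<in> regular_cells V h"
  shows "B \<subseteq> V" "basis_set B" "\<And>u. u \<in> V \<Longrightarrow> u \<notin> B \<Longrightarrow> lin_ext B h u < h u"
  using assms by (auto simp: regular_cells_def)

lemma finite_regular_cells: "finite V \<Longrightarrow> finite (regular_cells V h)"
  by (rule finite_subset[of _ "Pow V"]) (auto simp: regular_cells_def)

text \<open>
  The linear function that is \<open>1\<close> on \<open>B\<close> supports \<open>conv V\<close>, so the vectors of \<open>B\<close> share a facet and the gauge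
  of \<open>conv V\<close> is linear on the cone over \<open>B\<close>.
\<close>

lemma lin_ext_one_le:
  assumes h: "generic_heights V h" and B: "B \<in> regular_cells V h" and u: "u \<in> V"
  shows "lin_ext B (\<lambda>_. 1) u \<le> 1"
proof (cases "u \<in> B")
  case True
  then show ?thesis using regular_cellsD(2)[OF B] by (simp add: lin_ext_basis)
next
  case False
  then have "lin_ext B h u < h u" using regular_cellsD[OF B] u by auto
  then show ?thesis using h regular_cellsD[OF B] u False unfolding generic_heights_def
    by (metis Diff_iff not_less_iff_gr_or_eq linorder_not_le)
qed

text \<open>
  Weak duality: \<open>lin_ext B h\<close> is a feasible dual solution and \<open>B'\<close> a primal one for \<open>y\<close>; a vector of \<open>B'\<close>
  outside \<open>B\<close> would make the inequality between their values strict.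
\<close>

lemma regular_cells_interior_subset:
  assumes B: "B \<in> regular_cells V h" and B': "B' \<in> regular_cells V h"
    and pos: "\<And>v. v \<in> B \<Longrightarrow> representation B y v > 0" "\<And>v. v \<in> B' \<Longrightarrow> representation B' y v > 0"
    and le: "lin_ext B' h y \<le> lin_ext B h y"
  shows "B' \<subseteq> B"
proof (rule ccontr)
  assume "\<not> B' \<subseteq> B"
  then obtain u where u: "u \<in> B'" "u \<notin> B" by auto
  note bB = regular_cellsD[OF B] and bB' = regular_cellsD[OF B']
  have "lin_ext B h y = lin_ext B h (\<Sum>v\<in>B'. representation B' y v *\<^sub>R v)"
    by (simp add: coord_sum[OF bB'(2)])
  also have "\<dots> = (\<Sum>v\<in>B'. representation B' y v * lin_ext B h v)"
    by (rule lin_ext_sum[OF bB(2)])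
  also have "\<dots> < (\<Sum>v\<in>B'. representation B' y v * h v)"
  proof (rule sum_strict_mono_ex1)
    show "finite B'" using basis_setD[OF bB'(2)] by auto
    show "\<forall>x\<in>B'. representation B' y x * lin_ext B h x \<le> representation B' y x * h x"
    proof
      fix x assume x: "x \<in> B'"
      have "lin_ext B h x \<le> h x"
        using bB bB'(1) x lin_ext_basis[OF bB(2)] by (cases "x \<in> B") (auto intro: less_imp_le)
      then show "representation B' y x * lin_ext B h x \<le> representation B' y x * h x"
        using pos(2)[OF x] by (intro mult_left_mono) auto
    qed
    show "\<exists>a\<in>B'. representation B' y a * lin_ext B h a < representation B' y a * h a"
      using u bB(3)[of u] bB'(1) pos(2)[of u] by (intro bexI[of _ u]) auto
  qed
  also have "\<dots> = lin_ext B' h y" by (simp add: lin_ext_def)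
  finally show False using le by simp
qed

lemma regular_cells_interior_disjoint:
  assumes "B \<in> regular_cells V h" "B' \<in> regular_cells V h"
    and "\<And>v. v \<in> B \<Longrightarrow> representation B y v > 0" "\<And>v. v \<in> B' \<Longrightarrow> representation B' y v > 0"
  shows "B = B'"
proof -
  have "card B = card B'" "finite B" "finite B'"
    using assms(1,2) regular_cellsD(2) basis_setD by metis+
  moreover have "B' \<subseteq> B \<or> B \<subseteq> B'"
    using regular_cells_interior_subset[of B V h B' y] regular_cells_interior_subset[of B' V h B y] assms
    by (cases "lin_ext B' h y \<le> lin_ext B h y") auto
  ultimately show ?thesis by (metis card_subset_eq)
qed

text \<open>
  Such a point is on no wall of a cone spanned by vectors of \<open>V\<close>.
\<close>

definition generic_point :: "'a::euclidean_space set \<Rightarrow> 'a \<Rightarrow> bool" where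
  "generic_point V y \<longleftrightarrow> (\<forall>S\<subseteq>V. card S < DIM('a) \<longrightarrow> y \<notin> span S)"

lemma generic_coord_nonzero:
  fixes V :: "'a::euclidean_space set"
  assumes y: "generic_point V y" and B: "B \<subseteq> V" "basis_set B" and v: "v \<in> B"
  shows "representation B y v \<noteq> 0"
proof
  assume 0: "representation B y v = 0"
  note b = basis_setD[OF B(2)]
  have "y = (\<Sum>u\<in>B-{v}. representation B y u *\<^sub>R u)"
    using coord_sum[OF B(2), of y] sum.remove[OF b(2) v, of "\<lambda>u. representation B y u *\<^sub>R u"] 0 by simp
  also have "\<dots> \<in> span (B-{v})" by (intro span_sum span_scale span_base)
  finally have "y \<in> span (B - {v})" .
  moreover have "card (B-{v}) < DIM('a)"
    using b v by (metis card_Diff1_less)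
  ultimately show False using y B(1) unfolding generic_point_def by blast
qed

lemma exchange_basis_set:
  fixes B :: "'a::euclidean_space set"
  assumes B: "basis_set B" and p: "p \<in> B" and a: "representation B u p \<noteq> 0"
  shows "basis_set (insert u (B - {p}))"
proof -
  note b = basis_setD[OF B]
  have ni: "u \<notin> span (B - {p})"
  proof
    assume "u \<in> span (B - {p})"
    then obtain q where q: "u = (\<Sum>v\<in>B-{p}. q v *\<^sub>R v)"
      using b(2) by (auto simp: span_finite)
    have "u = (\<Sum>v\<in>B. (if v = p then 0 else q v) *\<^sub>R v)"
      unfolding q using b(2) p by (subst sum.remove[of B p]) (auto intro: sum.cong)
    then have "representation B u p = (if p = p then 0 else q p)"
      by (rule coord_eqI[OF B _ p])
    with a show False by simp
  qed
  then have "u \<notin> B - {p}" using span_base[of u "B - {p}"] by blast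
  moreover have "independent (insert u (B - {p}))"
    using independent_insertI[OF ni] independent_mono[OF b(1), of "B - {p}"] by auto
  ultimately show ?thesis using b p
    by (auto simp: basis_set_def card.insert_remove)
qed

text \<open>
  Among the bases whose cone contains \<open>y\<close>, take one of least cost \<open>lin_ext B h y\<close>. If some \<open>u\<close> violated
  the defining inequality, pivoting \<open>u\<close> into the basis would lower the cost: genericity of \<open>y\<close> makes
  the step length positive, and genericity of \<open>h\<close> makes the gain per unit of length positive.
\<close>

lemma regular_cells_cover:
  fixes V :: "'a::euclidean_space set"
  assumes V: "finite V" "0 \<in> interior (convex hull V)" and h: "generic_heights V h"
    and y: "generic_point V y"
  obtains B where "B \<in> regular_cells V h" "\<And>v. v \<in> B \<Longrightarrow> representation B y v > 0"
proof -
  define F where "F = {B. B \<subseteq> V \<and> basis_set B \<and> (\<forall>v\<in>B. 0 \<le> representation B y v)}"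
  have "finite F" by (rule finite_subset[of _ "Pow V"]) (use V in \<open>auto simp: F_def\<close>)
  moreover have "F \<noteq> {}"
  proof -
    obtain S d where S: "S \<subseteq> V" "independent S" "y = (\<Sum>v\<in>S. d v *\<^sub>R v)" "\<forall>v\<in>S. 0 \<le> d v"
      using nonneg_combination_of_hull[OF V, of y] conic_caratheodory[OF V(1), of y] by metis
    have "y \<in> span S" unfolding S(3) by (intro span_sum span_scale span_base)
    then have "\<not> card S < DIM('a)" using y S(1) by (auto simp: generic_point_def)
    moreover have "card S \<le> DIM('a)" using S(2) independent_bound by blast
    ultimately have "basis_set S" using S by (simp add: basis_set_def)
    then show ?thesis using S coord_eqI[of S y d] by (auto simp: F_def)
  qed
  ultimately obtain B where B: "B \<in> F" and opt: "\<And>B'. B' \<in> F \<Longrightarrow> lin_ext B h y \<le> lin_ext B' h y"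
    using arg_min_if_finite(1)[of F "\<lambda>B. lin_ext B h y"] arg_min_least[of F _ "\<lambda>B. lin_ext B h y"] by metis
  have bB: "B \<subseteq> V" "basis_set B" using B by (auto simp: F_def)
  note b = basis_setD[OF bB(2)]
  have pos: "representation B y v > 0" if "v \<in> B" for v
    using generic_coord_nonzero[OF y bB that] B that by (force simp: F_def)
  have "lin_ext B h u < h u" if u: "u \<in> V - B" for u
  proof (rule ccontr)
    assume "\<not> lin_ext B h u < h u"
    then have gt: "h u < lin_ext B h u"
      using h bB u unfolding generic_heights_def by (metis linorder_neqE_linordered_idom)
    (* Otherwise lin_ext B h u <= 0 < h u. So increasing the share of u ends at a basis. *)
    have "\<exists>v\<in>B. representation B u v > 0"
    proof (rule ccontr)
      assume "\<not> ?thesis"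
      then have "lin_ext B h u \<le> 0" unfolding lin_ext_def
        using h bB(1) by (intro sum_nonpos mult_nonpos_nonneg) (auto simp: generic_heights_def subset_iff intro: less_imp_le leI)
      moreover have "h u > 0" using h u by (auto simp: generic_heights_def)
      ultimately show False using gt by simp
    qed
    then obtain v0 where v0: "v0 \<in> B" "representation B u v0 > 0" by blast
    obtain p where p: "p \<in> B" "representation B u p > 0"
      "\<And>v. v \<in> B \<Longrightarrow> representation B y v \<ge> 0 \<Longrightarrow> representation B y p \<ge> 0 \<Longrightarrow>
        representation B y v - representation B y p / representation B u p * representation B u v \<ge> 0"
      using ratio_test[of B v0 "representation B u" "representation B y"] b(2) v0 by metis
    define \<theta> where "\<theta> = representation B y p / representation B u p"
    have \<theta>: "\<theta> > 0" using p pos by (simp add: \<theta>_def)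
    define B' where "B' = insert u (B - {p})"
    have B': "basis_set B'" unfolding B'_def using exchange_basis_set[OF bB(2) p(1)] p(2) by simp
    define d where "d v = (if v = u then \<theta> else representation B y v - \<theta> * representation B u v)" for v
    have uB: "u \<notin> B" using u by simp
    have zero: "representation B y p - \<theta> * representation B u p = 0"
      using p(2) by (simp add: \<theta>_def)
    have sumB': "(\<Sum>v\<in>B'. d v *\<^sub>R v) = \<theta> *\<^sub>R u + (\<Sum>v\<in>B. (representation B y v - \<theta> * representation B u v) *\<^sub>R v)"
    proof -
      have "(\<Sum>v\<in>B'. d v *\<^sub>R v) = \<theta> *\<^sub>R u + (\<Sum>v\<in>B-{p}. d v *\<^sub>R v)"
        unfolding B'_def using b(2) uB by (subst sum.insert) (auto simp: d_def)
      also have "(\<Sum>v\<in>B-{p}. d v *\<^sub>R v) = (\<Sum>v\<in>B-{p}. (representation B y v - \<theta> * representation B u v) *\<^sub>R v)"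
        using uB by (intro sum.cong) (auto simp: d_def)
      finally show ?thesis using sum.remove[OF b(2) p(1), of "\<lambda>v. (representation B y v - \<theta> * representation B u v) *\<^sub>R v"] zero
        by simp
    qed
    also have "(\<Sum>v\<in>B. (representation B y v - \<theta> * representation B u v) *\<^sub>R v) =
        (\<Sum>v\<in>B. representation B y v *\<^sub>R v) - \<theta> *\<^sub>R (\<Sum>v\<in>B. representation B u v *\<^sub>R v)"
      by (simp add: scaleR_diff_left sum_subtractf scaleR_sum_right)
    finally have y_eq: "y = (\<Sum>v\<in>B'. d v *\<^sub>R v)"
      by (simp add: coord_sum[OF bB(2)])
    note rep' = coord_eqI[OF B' y_eq]
    have dnn: "d v \<ge> 0" if "v \<in> B'" for v
      using that p(3)[of v] pos[of v] pos[of p] p(1) \<theta> unfolding \<theta>_def[symmetric]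
      by (auto simp: d_def B'_def intro: less_imp_le)
    have "B' \<in> F" using B' bB(1) u rep' dnn by (auto simp: F_def B'_def)
    have "lin_ext B' h y = (\<Sum>v\<in>B'. d v * h v)"
      unfolding lin_ext_def using rep' by (intro sum.cong) auto
    also have "\<dots> = \<theta> * h u + (\<Sum>v\<in>B-{p}. d v * h v)"
      unfolding B'_def using b(2) uB by (subst sum.insert) (auto simp: d_def)
    also have "(\<Sum>v\<in>B-{p}. d v * h v) = (\<Sum>v\<in>B-{p}. (representation B y v - \<theta> * representation B u v) * h v)"
      using uB by (intro sum.cong) (auto simp: d_def)
    also have "\<dots> = (\<Sum>v\<in>B. (representation B y v - \<theta> * representation B u v) * h v)"
      using sum.remove[OF b(2) p(1), of "\<lambda>v. (representation B y v - \<theta> * representation B u v) * h v"] zero by simp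
    also have "\<dots> = lin_ext B h y - \<theta> * lin_ext B h u"
      by (simp add: lin_ext_def algebra_simps sum_subtractf sum_distrib_left)
    finally have "lin_ext B' h y = lin_ext B h y - \<theta> * (lin_ext B h u - h u)" by (simp add: algebra_simps)
    moreover have "\<theta> * (lin_ext B h u - h u) > 0" using \<theta> gt by simp
    ultimately show False using opt[OF \<open>B' \<in> F\<close>] by simp
  qed
  then have "B \<in> regular_cells V h" using bB by (auto simp: regular_cells_def)
  then show thesis using pos by (rule that)
qed

section \<open>Half-open cones in a generic direction\<close>

text \<open>
  Finitely many proper subspaces do not cover the space, being negligible sets.
\<close>

lemma generic_point_exists:
  fixes V :: "'a::euclidean_space set"
  assumes "finite V"
  shows "\<exists>w. generic_point V w"
proof -
  let ?F = "{S. S \<subseteq> V \<and> card S < DIM('a)}"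
  have "negligible (\<Union>S\<in>?F. span S)"
  proof (rule negligible_Union)
    show "finite (span ` ?F)" using assms by auto
    fix T assume "T \<in> span ` ?F"
    then obtain S where S: "T = span S" "S \<subseteq> V" "card S < DIM('a)" by auto
    have "dim S \<le> card S" using S finite_subset[OF S(2) assms] by (simp add: dim_le_card')
    then show "negligible T" using S by (intro negligible_lowdim) auto
  qed
  then have "(\<Union>S\<in>?F. span S) \<noteq> UNIV" by auto
  then show ?thesis unfolding generic_point_def by auto
qed

lemma generic_point_minus: "generic_point V w \<Longrightarrow> generic_point V (- w)"
  unfolding generic_point_def by (metis minus_minus span_neg)

lemma eventually_generic_point:
  fixes V :: "'a::euclidean_space set"
  assumes "finite V" and w: "generic_point V w"
  shows "eventually (\<lambda>e. generic_point V (x + e *\<^sub>R w)) (at_right 0)"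
proof -
  let ?F = "{S. S \<subseteq> V \<and> card S < DIM('a)}"
  have "eventually (\<lambda>e. \<forall>S\<in>?F. x + e *\<^sub>R w \<notin> span S) (at_right 0)"
  proof (rule eventually_ball_finite)
    show "\<forall>S\<in>?F. eventually (\<lambda>e. x + e *\<^sub>R w \<notin> span S) (at_right 0)"
    proof
      fix S assume S: "S \<in> ?F"
      have one: "e1 = e2" if e: "x + e1 *\<^sub>R w \<in> span S" "x + e2 *\<^sub>R w \<in> span S" for e1 e2
      proof (rule ccontr)
        assume ne: "e1 \<noteq> e2"
        have "(x + e1 *\<^sub>R w) - (x + e2 *\<^sub>R w) \<in> span S" using e by (rule span_diff)
        then have "(e1 - e2) *\<^sub>R w \<in> span S" by (simp add: algebra_simps)
        then have "(1 / (e1 - e2)) *\<^sub>R (e1 - e2) *\<^sub>R w \<in> span S" by (rule span_scale)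
        then have "w \<in> span S" using ne by simp
        with w S show False by (auto simp: generic_point_def)
      qed
      have "finite {e. x + e *\<^sub>R w \<in> span S}"
      proof (cases "\<exists>e0. x + e0 *\<^sub>R w \<in> span S")
        case True
        then obtain e0 where "x + e0 *\<^sub>R w \<in> span S" by blast
        then have "{e. x + e *\<^sub>R w \<in> span S} \<subseteq> {e0}" using one by blast
        then show ?thesis by (rule finite_subset) simp
      qed auto
      then have "eventually (\<lambda>e. e \<notin> {e. x + e *\<^sub>R w \<in> span S}) (at 0)"
        by (metis islimpt_finite islimpt_iff_eventually)
      then show "eventually (\<lambda>e. x + e *\<^sub>R w \<notin> span S) (at_right 0)"
        unfolding eventually_at_split by auto
    qed
  qed (use assms in auto)
  then show ?thesis by (rule eventually_mono) (auto simp: generic_point_def)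
qed

text \<open>
  The points \<open>x\<close> for which \<open>x + e w\<close> is in the interior of the cone over \<open>B\<close> for all small \<open>e > 0\<close>.
\<close>

definition half_open_cone :: "'a::euclidean_space \<Rightarrow> 'a set \<Rightarrow> 'a set" where
  "half_open_cone w B =
     {x. \<forall>v\<in>B. 0 < representation B x v \<or> representation B x v = 0 \<and> 0 < representation B w v}"

text \<open>
  Lattice points of the half-open cone, with the coordinates in \<open>A\<close> restricted to a half-open unit
  interval: \<open>[0,1)\<close> where \<open>w\<close> has a positive coordinate and \<open>(0,1]\<close> where it has a negative one. So \<open>A = {}\<close>
  gives the whole cone and \<open>A = B\<close> the fundamental box.
\<close>

definition half_open_slab :: "'a::euclidean_space \<Rightarrow> 'a set \<Rightarrow> 'a set \<Rightarrow> 'a set" where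
  "half_open_slab w B A = {x \<in> half_open_cone w B \<inter> int_points.
     \<forall>v\<in>A. representation B x v < 1 \<or> representation B x v = 1 \<and> representation B w v < 0}"

lemma half_open_coneD: "x \<in> half_open_cone w B \<Longrightarrow> v \<in> B \<Longrightarrow> 0 \<le> representation B x v"
  by (force simp: half_open_cone_def)

lemma eventually_pos_affine:
  fixes a b :: real
  assumes "0 < a \<or> a = 0 \<and> 0 < b"
  shows "eventually (\<lambda>e. 0 < a + e * b) (at_right 0)"
proof (cases "a > 0")
  case True
  have "((\<lambda>e. a + e * b) \<longlongrightarrow> a + 0 * b) (at_right 0)" by (intro tendsto_intros)
  from order_tendstoD(1)[OF this] True show ?thesis by simp
next
  case False
  then show ?thesis using assms eventually_at_right_less[of "0::real"] by (auto elim: eventually_mono)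
qed

text \<open>
  For small \<open>e > 0\<close> the point \<open>x + e w\<close> is generic and hence in the interior of a cone. As there are
  finitely many cones, one of them contains it for arbitrarily small \<open>e\<close>, hence for all small \<open>e\<close>;
  disjointness of the interiors gives uniqueness.
\<close>

lemma half_open_partition:
  fixes V :: "'a::euclidean_space set"
  assumes V: "finite V" "0 \<in> interior (convex hull V)" and h: "generic_heights V h"
    and w: "generic_point V w"
  shows "\<exists>!B. B \<in> regular_cells V h \<and> x \<in> half_open_cone w B"
proof (rule ex_ex1I)
  have nz: "representation B w v \<noteq> 0" if "B \<in> regular_cells V h" "v \<in> B" for B v
    using generic_coord_nonzero[OF w] regular_cellsD[OF that(1)] that(2) by auto
  have rep: "representation B (x + e *\<^sub>R w) v = representation B x v + e * representation B w v"
    if "B \<in> regular_cells V h" for B v e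
    using regular_cellsD[OF that] by (simp add: coord_linear)
  have "eventually (\<lambda>e. \<exists>B\<in>regular_cells V h. \<forall>v\<in>B. 0 < representation B (x + e *\<^sub>R w) v) (at_right 0)"
    using eventually_generic_point[OF V(1) w, of x]
  proof eventually_elim
    case (elim e)
    show ?case by (rule regular_cells_cover[OF V h elim]) blast
  qed
  then have "frequently (\<lambda>e. \<exists>B\<in>regular_cells V h. \<forall>v\<in>B. 0 < representation B (x + e *\<^sub>R w) v) (at_right (0::real))"
    by (rule eventually_frequently[rotated]) simp
  then obtain B where B: "B \<in> regular_cells V h"
    and fr: "frequently (\<lambda>e. \<forall>v\<in>B. 0 < representation B (x + e *\<^sub>R w) v) (at_right 0)"
    using frequently_bex_finite[OF finite_regular_cells[OF V(1), of h],
        where P = "\<lambda>e B. \<forall>v\<in>B. 0 < representation B (x + e *\<^sub>R w) v"] by blast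
  have "0 < representation B x v \<or> representation B x v = 0 \<and> 0 < representation B w v" if v: "v \<in> B" for v
  proof (rule ccontr)
    assume neg: "\<not> ?thesis"
    have "0 < - representation B x v \<or> - representation B x v = 0 \<and> 0 < - representation B w v"
      using neg nz[OF B v] by linarith
    from eventually_pos_affine[OF this]
    have "eventually (\<lambda>e. \<not> (\<forall>v\<in>B. 0 < representation B (x + e *\<^sub>R w) v)) (at_right 0)"
      by (rule eventually_mono) (use v in \<open>auto simp: rep[OF B] intro!: bexI[of _ v]\<close>)
    then show False using fr by (simp add: frequently_def)
  qed
  then show "\<exists>B. B \<in> regular_cells V h \<and> x \<in> half_open_cone w B"
    using B by (auto simp: half_open_cone_def)
next
  fix B B' assume B: "B \<in> regular_cells V h \<and> x \<in> half_open_cone w B"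
    and B': "B' \<in> regular_cells V h \<and> x \<in> half_open_cone w B'"
  have ev: "eventually (\<lambda>e. \<forall>v\<in>B. 0 < representation B (x + e *\<^sub>R w) v) (at_right 0)"
    if "B \<in> regular_cells V h \<and> x \<in> half_open_cone w B" for B
  proof (rule eventually_ball_finite)
    show "finite B" using that regular_cellsD(2) basis_setD(2) by blast
    show "\<forall>v\<in>B. eventually (\<lambda>e. 0 < representation B (x + e *\<^sub>R w) v) (at_right 0)"
      using that regular_cellsD(2)[of B V h]
      by (auto simp: coord_linear half_open_cone_def intro!: eventually_pos_affine)
  qed
  have "eventually (\<lambda>e. B = B') (at_right (0::real))"
    using ev[OF B] ev[OF B']
  proof eventually_elim
    case (elim e)
    show ?case by (rule regular_cells_interior_disjoint[of B V h B' "x + e *\<^sub>R w"]) (use elim B B' in auto)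
  qed
  then show "B = B'" by simp
qed

section \<open>Generating functions and symmetric polynomials\<close>

(* In this and the next two sections the dollar sign denotes coefficients of power series. *)
unbundle no vec_syntax

definition level_fps :: "('a \<Rightarrow> nat) \<Rightarrow> 'a set \<Rightarrow> int fps" where
  "level_fps N S = Abs_fps (\<lambda>n. int (card {x\<in>S. N x = n}))"

lemma level_fps_Diff:
  assumes "T \<subseteq> S" "\<And>n. finite {x\<in>S. N x = n}"
  shows "level_fps N (S - T) = level_fps N S - level_fps N T"
proof (rule fps_ext)
  fix n
  have "{x\<in>S - T. N x = n} = {x\<in>S. N x = n} - {x\<in>T. N x = n}" by auto
  moreover have "finite {x\<in>T. N x = n}" "{x\<in>T. N x = n} \<subseteq> {x\<in>S. N x = n}"
    using assms by (auto intro: finite_subset[OF _ assms(2)[of n]])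
  ultimately show "level_fps N (S - T) $ n = (level_fps N S - level_fps N T) $ n"
    using card_mono[OF assms(2)[of n], of "{x\<in>T. N x = n}"]
    by (simp add: level_fps_def card_Diff_subset of_nat_diff)
qed

lemma level_fps_translate:
  fixes v :: "'a::ab_group_add"
  assumes "\<And>x. x \<in> S \<Longrightarrow> N (v + x) = N x + m"
  shows "level_fps N ((+) v ` S) = fps_X ^ m * level_fps N S"
proof (rule fps_ext)
  fix n
  have "{x\<in>(+) v ` S. N x = n} = (+) v ` {x\<in>S. N x + m = n}" using assms by auto
  then have "card {x\<in>(+) v ` S. N x = n} = card {x\<in>S. N x + m = n}"
    by (simp add: card_image)
  moreover have "{x\<in>S. N x + m = n} = (if n < m then {} else {x\<in>S. N x = n - m})" by auto
  ultimately show "level_fps N ((+) v ` S) $ n = (fps_X ^ m * level_fps N S) $ n"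
    by (simp add: level_fps_def fps_X_power_mult_nth)
qed

lemma level_fps_disjoint_UN:
  assumes "finite I" "\<And>i j. i \<in> I \<Longrightarrow> j \<in> I \<Longrightarrow> i \<noteq> j \<Longrightarrow> S i \<inter> S j = {}"
    and "\<And>i n. i \<in> I \<Longrightarrow> finite {x\<in>S i. N x = n}"
  shows "level_fps N (\<Union>i\<in>I. S i) = (\<Sum>i\<in>I. level_fps N (S i))"
proof (rule fps_ext)
  fix n
  have "{x\<in>(\<Union>i\<in>I. S i). N x = n} = (\<Union>i\<in>I. {x\<in>S i. N x = n})" by auto
  moreover have "card \<dots> = (\<Sum>i\<in>I. card {x\<in>S i. N x = n})"
    using assms by (intro card_UN_disjoint) blast+
  ultimately show "level_fps N (\<Union>i\<in>I. S i) $ n = (\<Sum>i\<in>I. level_fps N (S i)) $ n"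
    by (simp add: level_fps_def fps_sum_nth)
qed

text \<open>
  Symmetry about \<open>D/2\<close> only means palindromicity if \<open>D\<close> is the degree, which the nonzero constant
  coefficient guarantees.
\<close>

lemma reflect_poly_eqI:
  fixes p :: "'b::comm_ring_1 poly"
  assumes "\<And>i. D < i \<Longrightarrow> coeff p i = 0" "\<And>i. i \<le> D \<Longrightarrow> coeff p (D - i) = coeff p i" "coeff p 0 \<noteq> 0"
  shows "reflect_poly p = p"
proof -
  have "coeff p D \<noteq> 0" using assms(2)[of 0] assms(3) by simp
  then have "degree p = D" using assms(1) by (meson degree_le le_degree le_antisym)
  then show ?thesis using assms by (intro poly_eqI) (auto simp: coeff_reflect_poly)
qed

lemma fps_of_poly_exists:
  fixes F :: "'b::zero fps"
  assumes "\<And>i. D < i \<Longrightarrow> F $ i = 0"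
  shows "\<exists>p. fps_of_poly p = F"
  by (rule exI[of _ "Poly (map (fps_nth F) [0..<Suc D])"], rule fps_ext)
     (use assms in \<open>auto simp: nth_default_def simp del: upt_Suc\<close>)

section \<open>Lattice points\<close>

lemma finite_bounded_int_points:
  fixes S :: "'a::euclidean_space set"
  assumes "bounded S"
  shows "finite (S \<inter> int_points)"
proof -
  obtain K where K: "\<And>x. x \<in> S \<Longrightarrow> norm x \<le> K" using assms by (auto simp: bounded_iff)
  let ?G = "Pi\<^sub>E (Basis::'a set) (\<lambda>_. {t\<in>\<int>. -K \<le> t \<and> t \<le> K})"
  have "S \<inter> int_points \<subseteq> (\<lambda>g. \<Sum>b\<in>Basis. g b *\<^sub>R b) ` ?G"
  proof
    fix x assume x: "x \<in> S \<inter> int_points"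
    have "x = (\<Sum>b\<in>Basis. (\<lambda>b\<in>Basis. x \<bullet> b) b *\<^sub>R b)"
      using euclidean_representation[of x] by (simp cong: sum.cong)
    moreover have "(\<lambda>b\<in>Basis. x \<bullet> b) \<in> ?G"
      using x K[of x] Basis_le_norm[of _ x] by (force simp: int_points_def abs_le_iff)
    ultimately show "x \<in> (\<lambda>g. \<Sum>b\<in>Basis. g b *\<^sub>R b) ` ?G" by blast
  qed
  moreover have "finite ?G" by (intro finite_PiE finite_Basis finite_int_segment)
  ultimately show ?thesis by (meson finite_imageI finite_subset)
qed

lemma int_points_add: "x \<in> int_points \<Longrightarrow> y \<in> int_points \<Longrightarrow> x + y \<in> int_points"
  by (auto simp: int_points_def inner_add_left)

lemma int_points_diff: "x \<in> int_points \<Longrightarrow> y \<in> int_points \<Longrightarrow> x - y \<in> int_points"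
  by (auto simp: int_points_def inner_diff_left)

lemma int_points_sum: "(\<And>i. i \<in> I \<Longrightarrow> f i \<in> int_points) \<Longrightarrow> sum f I \<in> int_points"
  by (auto simp: int_points_def inner_sum_left)

section \<open>Symmetry of the generating function of an integral gauge\<close>

text \<open>
  \<open>N\<close> is \<open>m\<close> times the gauge of the lattice polytope \<open>conv V\<close>; the assumption is that it is integral on
  the lattice, which expresses the codenominator condition without reference to halfspaces.
\<close>

locale lattice_gauge =
  fixes V :: "'a::euclidean_space set" and m :: nat and N :: "'a \<Rightarrow> nat"
  assumes finite_V: "finite V" and V_int: "V \<subseteq> int_points"
    and zero_interior: "0 \<in> interior (convex hull V)" and m_pos: "0 < m"
    and gauge: "\<And>x t. x \<in> int_points \<Longrightarrow> 0 \<le> t \<Longrightarrow>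
      x \<in> dilate (t / real m) (convex hull V) \<longleftrightarrow> real (N x) \<le> t"
begin

lemma finite_sublevel: "finite {x\<in>int_points. N x \<le> n}"
proof -
  have "bounded (dilate (real n / real m) (convex hull V))"
    unfolding dilate_def by (intro bounded_scaling finite_imp_bounded_convex_hull finite_V)
  then have "finite (dilate (real n / real m) (convex hull V) \<inter> int_points)"
    by (rule finite_bounded_int_points)
  then show ?thesis by (rule rev_finite_subset) (auto simp: gauge)
qed

lemma finite_level: "S \<subseteq> int_points \<Longrightarrow> finite {x\<in>S. N x = n}"
  by (rule finite_subset[OF _ finite_sublevel[of n]]) auto

text \<open>
  The hull of \<open>B\<close> is part of \<open>conv V\<close>, which bounds the gauge from above, and \<open>lin_ext B (\<lambda>_. 1)\<close> is at most
  \<open>1\<close> on \<open>conv V\<close>, which bounds it from below.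
\<close>

lemma gauge_on_cell:
  assumes h: "generic_heights V h" and B: "B \<in> regular_cells V h" and x: "x \<in> int_points"
    and nn: "\<And>v. v \<in> B \<Longrightarrow> 0 \<le> representation B x v"
  shows "real (N x) = real m * lin_ext B (\<lambda>_. 1) x"
proof -
  define s where "s = lin_ext B (\<lambda>_. 1) x"
  note cell = regular_cellsD[OF B]
  note b = basis_setD[OF cell(2)]
  have s: "s = (\<Sum>v\<in>B. representation B x v)" by (simp add: s_def lin_ext_def)
  have s0: "s \<ge> 0" unfolding s using nn by (intro sum_nonneg) auto
  have "x \<in> dilate s (convex hull V)"
  proof (cases "s = 0")
    case True
    then have "\<forall>v\<in>B. representation B x v = 0" unfolding s using nn b(2) by (simp add: sum_nonneg_eq_0_iff)
    then have "x = 0" using coord_sum[OF cell(2), of x] by simp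
    moreover have "0 \<in> convex hull V" using zero_interior interior_subset by blast
    ultimately show ?thesis using True by (force simp: dilate_def)
  next
    case False
    let ?q = "\<Sum>v\<in>B. (representation B x v / s) *\<^sub>R v"
    have "?q \<in> convex hull B"
      unfolding convex_hull_finite[OF b(2)]
      using s nn s0 False by (auto intro!: exI[of _ "\<lambda>v. representation B x v / s"] simp: sum_divide_distrib[symmetric])
    then have "?q \<in> convex hull V" using hull_mono[OF cell(1)] by blast
    moreover have "x = s *\<^sub>R ?q" using False coord_sum[OF cell(2), of x] by (simp add: scaleR_sum_right)
    ultimately show ?thesis by (auto simp: dilate_def)
  qed
  then have "real (N x) \<le> real m * s"
    using gauge[OF x, of "real m * s"] s0 m_pos by simp
  moreover have "s \<le> real (N x) / real m"
  proof -
    have "x \<in> dilate (real (N x) / real m) (convex hull V)" using gauge[OF x] by simp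
    then obtain q where q: "q \<in> convex hull V" "x = (real (N x) / real m) *\<^sub>R q" by (auto simp: dilate_def)
    have "convex (lin_ext B (\<lambda>_. 1) -` {..1})"
      by (intro convex_linear_vimage linear_lin_ext cell) simp
    then have "convex hull V \<subseteq> lin_ext B (\<lambda>_. 1) -` {..1}"
      using lin_ext_one_le[OF h B] by (intro hull_minimal) auto
    then have "lin_ext B (\<lambda>_. 1) q \<le> 1" using q by auto
    then have "real (N x) / real m * lin_ext B (\<lambda>_. 1) q \<le> real (N x) / real m"
      using mult_left_mono[of "lin_ext B (\<lambda>_. 1) q" 1 "real (N x) / real m"] by simp
    moreover have "s = real (N x) / real m * lin_ext B (\<lambda>_. 1) q"
      unfolding s_def by (subst q(2)) (simp add: linear_cmul[OF linear_lin_ext[OF cell(2)]])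
    ultimately show ?thesis by simp
  qed
  ultimately show ?thesis using m_pos by (simp add: s_def field_simps)
qed

lemma gauge_translate:
  assumes h: "generic_heights V h" and B: "B \<in> regular_cells V h" and v: "v \<in> B"
    and x: "x \<in> half_open_cone w B \<inter> int_points"
  shows "N (v + x) = N x + m"
proof -
  note cell = regular_cellsD[OF B]
  have vi: "v + x \<in> int_points" using V_int cell(1) v x by (auto intro: int_points_add)
  have nn: "0 \<le> representation B x u" if "u \<in> B" for u using half_open_coneD[of x w B u] x that by auto
  have "real (N (v + x)) = real m * lin_ext B (\<lambda>_. 1) (v + x)"
    using nn v by (intro gauge_on_cell[OF h B vi]) (auto simp: coord_linear[OF cell(2)] coord_basis[OF cell(2)])
  also have "\<dots> = real m * lin_ext B (\<lambda>_. 1) x + real m"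
    using linear_add[OF linear_lin_ext[OF cell(2)]] lin_ext_basis[OF cell(2) v] by (simp add: algebra_simps)
  also have "real m * lin_ext B (\<lambda>_. 1) x = real (N x)"
    using gauge_on_cell[OF h B _ nn] x by simp
  finally show ?thesis by linarith
qed

text \<open>
  Translation by a generator \<open>v\<close> maps the slab into itself; the points missed are those whose
  coordinate at \<open>v\<close> drops out of the half-open ray when \<open>v\<close> is subtracted.
\<close>

lemma slab_peel:
  assumes h: "generic_heights V h" and w: "generic_point V w" and B: "B \<in> regular_cells V h"
    and A: "A \<subseteq> B" "v \<in> B" "v \<notin> A"
  shows "half_open_slab w B (insert v A) = half_open_slab w B A - (+) v ` half_open_slab w B A"
    and "(+) v ` half_open_slab w B A \<subseteq> half_open_slab w B A"
proof -
  note cell = regular_cellsD[OF B]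
  have nz: "representation B w v \<noteq> 0" using generic_coord_nonzero[OF w cell(1,2) A(2)] .
  have vi: "v \<in> int_points" using V_int cell A by auto
  have img: "x \<in> (+) v ` half_open_slab w B A \<longleftrightarrow> x - v \<in> half_open_slab w B A" for x
    by (metis (no_types, lifting) add_diff_cancel_left' diff_add_cancel add.commute image_iff)
  have rep: "representation B (x - v) u = representation B x u - (if u = v then 1 else 0)" for x u
    using A by (simp add: coord_linear[OF cell(2)] coord_basis[OF cell(2)])
  have int: "x - v \<in> int_points \<longleftrightarrow> x \<in> int_points" for x
    using int_points_diff[OF _ vi, of x] int_points_add[OF _ vi, of "x - v"] by auto
  have sub: "x - v \<in> half_open_slab w B A \<longleftrightarrow> x \<in> half_open_slab w B A \<and>
      (1 < representation B x v \<or> representation B x v = 1 \<and> 0 < representation B w v)" for x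
    using A unfolding half_open_slab_def half_open_cone_def mem_Collect_eq Int_iff int rep by auto
  show "(+) v ` half_open_slab w B A \<subseteq> half_open_slab w B A"
    using img sub by blast
  show "half_open_slab w B (insert v A) = half_open_slab w B A - (+) v ` half_open_slab w B A"
  proof (rule set_eqI)
    fix x
    have "x \<in> half_open_slab w B (insert v A) \<longleftrightarrow> x \<in> half_open_slab w B A \<and>
      (representation B x v < 1 \<or> representation B x v = 1 \<and> representation B w v < 0)"
      by (auto simp: half_open_slab_def)
    then show "x \<in> half_open_slab w B (insert v A) \<longleftrightarrow> x \<in> half_open_slab w B A - (+) v ` half_open_slab w B A"
      unfolding Diff_iff img sub using nz by force
  qed
qed

text \<open>
  Translation by a generator multiplies the generating function by \<open>X\<^sup>m\<close>, so each peeling step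
  contributes one factor \<open>1 - X\<^sup>m\<close>.
\<close>

lemma level_fps_slab:
  assumes h: "generic_heights V h" and w: "generic_point V w" and B: "B \<in> regular_cells V h"
    and "finite A" "A \<subseteq> B"
  shows "level_fps N (half_open_slab w B A) = (1 - fps_X ^ m) ^ card A * level_fps N (half_open_slab w B {})"
  using assms(4,5)
proof (induction A)
  case (insert v A)
  have v: "A \<subseteq> B" "v \<in> B" "v \<notin> A" using insert by auto
  note peel = slab_peel[OF h w B v]
  have "level_fps N (half_open_slab w B (insert v A)) =
      level_fps N (half_open_slab w B A) - level_fps N ((+) v ` half_open_slab w B A)"
    unfolding peel(1) by (intro level_fps_Diff peel(2) finite_level) (auto simp: half_open_slab_def)
  also have "level_fps N ((+) v ` half_open_slab w B A) = fps_X ^ m * level_fps N (half_open_slab w B A)"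
    by (intro level_fps_translate gauge_translate[OF h B v(2), where w = w]) (auto simp: half_open_slab_def)
  finally show ?case using insert by (simp add: algebra_simps)
qed simp

lemma level_fps_boxes:
  assumes h: "generic_heights V h" and w: "generic_point V w"
  shows "(1 - fps_X ^ m) ^ DIM('a) * level_fps N int_points =
    (\<Sum>B\<in>regular_cells V h. level_fps N (half_open_slab w B B))"
proof -
  note part = half_open_partition[OF finite_V zero_interior h w]
  have "int_points = (\<Union>B\<in>regular_cells V h. half_open_slab w B {})"
    using part unfolding half_open_slab_def by blast
  also have "level_fps N \<dots> = (\<Sum>B\<in>regular_cells V h. level_fps N (half_open_slab w B {}))"
  proof (rule level_fps_disjoint_UN)
    show "half_open_slab w B {} \<inter> half_open_slab w B' {} = {}"
      if "B \<in> regular_cells V h" "B' \<in> regular_cells V h" "B \<noteq> B'" for B B'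
      using part that unfolding half_open_slab_def by blast
  qed (auto intro!: finite_regular_cells finite_V finite_level simp: half_open_slab_def)
  finally have "(1 - fps_X ^ m) ^ DIM('a) * level_fps N int_points =
     (\<Sum>B\<in>regular_cells V h. (1 - fps_X ^ m) ^ DIM('a) * level_fps N (half_open_slab w B {}))"
    by (simp add: sum_distrib_left)
  also have "\<dots> = (\<Sum>B\<in>regular_cells V h. level_fps N (half_open_slab w B B))"
  proof (rule sum.cong)
    fix B assume B: "B \<in> regular_cells V h"
    from level_fps_slab[OF h w B, of B] basis_setD[OF regular_cellsD(2)[OF B]]
    show "(1 - fps_X ^ m) ^ DIM('a) * level_fps N (half_open_slab w B {}) = level_fps N (half_open_slab w B B)"
      by simp
  qed simp
  finally show ?thesis .
qed

text \<open>
  Every coordinate \<open>c\<close> becomes \<open>1 - c\<close>, which exchanges \<open>[0,1)\<close> with \<open>(0,1]\<close>, as does replacing \<open>w\<close> by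
  \<open>-w\<close>; and \<open>N\<close> is \<open>m\<close> times the sum of the coordinates.
\<close>

lemma box_reflect:
  assumes h: "generic_heights V h" and w: "generic_point V w" and B: "B \<in> regular_cells V h"
    and x: "x \<in> half_open_slab w B B"
  shows "\<Sum>B - x \<in> half_open_slab (- w) B B" and "N (\<Sum>B - x) + N x = m * DIM('a)"
proof -
  note cell = regular_cellsD[OF B]
  note b = basis_setD[OF cell(2)]
  have rep: "representation B (\<Sum>B - x) v = 1 - representation B x v" if v: "v \<in> B" for v
  proof -
    have "representation B (\<Sum>B) v = 1"
      by (rule coord_eqI[OF cell(2) _ v]) simp
    then show ?thesis by (simp add: coord_linear(2)[OF cell(2)])
  qed
  have xi: "x \<in> int_points" using x by (auto simp: half_open_slab_def)
  have si: "\<Sum>B - x \<in> int_points" using V_int cell(1) xi by (intro int_points_diff int_points_sum) auto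
  have rx: "0 \<le> representation B x v" "representation B x v \<le> 1" if "v \<in> B" for v
    using x that by (force simp: half_open_slab_def half_open_cone_def)+
  show "\<Sum>B - x \<in> half_open_slab (- w) B B"
    using x si unfolding half_open_slab_def half_open_cone_def
    by (auto simp: rep coord_linear(4)[OF cell(2)])
  have "real (N (\<Sum>B - x)) = real m * lin_ext B (\<lambda>_. 1) (\<Sum>B - x)"
    using rx by (intro gauge_on_cell[OF h B si]) (simp add: rep)
  moreover have "real (N x) = real m * lin_ext B (\<lambda>_. 1) x"
    using rx by (intro gauge_on_cell[OF h B xi])
  moreover have "lin_ext B (\<lambda>_. 1) (\<Sum>B - x) = real (DIM('a)) - lin_ext B (\<lambda>_. 1) x"
    using b by (simp add: lin_ext_def rep sum_subtractf cong: sum.cong)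
  ultimately have "real (N (\<Sum>B - x) + N x) = real (m * DIM('a))" by (simp add: algebra_simps)
  then show "N (\<Sum>B - x) + N x = m * DIM('a)" by (rule of_nat_eq_iff[THEN iffD1])
qed

lemma card_box_reflect:
  assumes h: "generic_heights V h" and w: "generic_point V w" and B: "B \<in> regular_cells V h"
    and i: "i \<le> m * DIM('a)"
  shows "card {x\<in>half_open_slab (- w) B B. N x = i} = card {x\<in>half_open_slab w B B. N x = m * DIM('a) - i}"
proof -
  note r1 = box_reflect[OF h w B] and r2 = box_reflect[OF h generic_point_minus[OF w] B, simplified]
  have "bij_betw (\<lambda>x. \<Sum>B - x) {x\<in>half_open_slab w B B. N x = m * DIM('a) - i} {x\<in>half_open_slab (- w) B B. N x = i}"
    by (rule bij_betwI[where g = "\<lambda>x. \<Sum>B - x"]) (use r1 r2 i in \<open>force+\<close>)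
  then show ?thesis by (simp add: bij_betw_same_card)
qed

text \<open>
  The left-hand side of \<open>level_fps_boxes\<close> does not involve \<open>w\<close>, so its coefficients can be read off from
  the boxes for \<open>w\<close> or from the reflected boxes for \<open>-w\<close>.
\<close>

lemma level_fps_symmetric:
  fixes F :: "int fps"
  defines "F \<equiv> (1 - fps_X ^ m) ^ DIM('a) * level_fps N int_points"
  shows "m * DIM('a) < i \<Longrightarrow> F $ i = 0" and "i \<le> m * DIM('a) \<Longrightarrow> F $ (m * DIM('a) - i) = F $ i"
proof -
  obtain h where h: "generic_heights V h" using generic_heights_exist[OF finite_V] by blast
  obtain w where w: "generic_point V w" using generic_point_exists[OF finite_V] by blast
  have F: "F $ i = (\<Sum>B\<in>regular_cells V h. int (card {x\<in>half_open_slab w B B. N x = i}))"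
    if "generic_point V w" for i w
    unfolding F_def level_fps_boxes[OF h that] by (simp add: fps_sum_nth level_fps_def)
  show "F $ i = 0" if "m * DIM('a) < i"
  proof -
    have "card {x\<in>half_open_slab w B B. N x = i} = 0" if B: "B \<in> regular_cells V h" for B
    proof -
      have "{x\<in>half_open_slab w B B. N x = i} = {}"
        using box_reflect(2)[OF h w B] \<open>m * DIM('a) < i\<close> by fastforce
      then show ?thesis by (simp only: card.empty)
    qed
    then show ?thesis unfolding F[OF w] by (simp del: card_eq_0_iff)
  qed
  show "F $ (m * DIM('a) - i) = F $ i" if "i \<le> m * DIM('a)"
  proof -
    have "F $ i = (\<Sum>B\<in>regular_cells V h. int (card {x\<in>half_open_slab (- w) B B. N x = i}))"
      by (rule F[OF generic_point_minus[OF w]])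
    also have "\<dots> = F $ (m * DIM('a) - i)"
      unfolding F[OF w] by (intro sum.cong refl) (simp add: card_box_reflect[OF h w _ that])
    finally show ?thesis by simp
  qed
qed

lemma gauge_zero: "{x\<in>int_points. N x = 0} = {0}"
proof -
  have "convex hull V \<noteq> {}" using zero_interior interior_subset by blast
  then have "x \<in> dilate (0 / real m) (convex hull V) \<longleftrightarrow> x = 0" for x :: 'a
    by (simp add: dilate_def image_constant_conv)
  moreover have "0 \<in> (int_points :: 'a set)" by (simp add: int_points_def)
  ultimately show ?thesis using gauge[of _ 0] by auto
qed

lemma hstar_palindromic:
  assumes E: "\<And>n. E $ n = int (card {x\<in>int_points. N x \<le> n})"
  shows "\<exists>h. fps_of_poly h = (1 - fps_X ^ m) ^ (DIM('a) + 1) * E \<and> reflect_poly h = h"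
proof -
  have "(1 - fps_X) * E = level_fps N int_points"
  proof (rule fps_ext)
    fix n
    show "((1 - fps_X) * E) $ n = level_fps N int_points $ n"
    proof (cases n)
      case (Suc k)
      have "{x\<in>int_points. N x \<le> Suc k} = {x\<in>int_points. N x \<le> k} \<union> {x\<in>int_points. N x = Suc k}"
        by auto
      moreover have "card \<dots> = card {x\<in>int_points. N x \<le> k} + card {x\<in>int_points. N x = Suc k}"
        using finite_sublevel finite_level by (intro card_Un_disjoint) auto
      ultimately show ?thesis using Suc by (simp add: level_fps_def algebra_simps E)
    qed (simp add: level_fps_def algebra_simps E)
  qed
  moreover have "(1::int fps) - fps_X ^ m = (1 - fps_X) * (\<Sum>i<m. fps_X ^ i)"
    by (rule one_diff_power_eq)
  ultimately have eq: "(1 - fps_X ^ m) ^ (DIM('a) + 1) * E =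
      (\<Sum>i<m. fps_X ^ i) * ((1 - fps_X ^ m) ^ DIM('a) * level_fps N int_points)"
    by (simp add: mult_ac)
  obtain p where p: "fps_of_poly p = (1 - fps_X ^ m) ^ DIM('a) * level_fps N int_points"
    using fps_of_poly_exists[OF level_fps_symmetric(1)] by blast
  have "coeff p 0 = 1"
    unfolding fps_of_poly_nth[symmetric] p using m_pos
    by (simp add: fps_mult_nth_0 fps_power_zeroth level_fps_def gauge_zero power_0_left)
  then have rp: "reflect_poly p = p"
    using level_fps_symmetric unfolding p[symmetric]
    by (intro reflect_poly_eqI[of "m * DIM('a)"]) auto
  define q :: "int poly" where "q = (\<Sum>i<m. monom 1 i)"
  have cq: "coeff q i = (if i < m then 1 else 0)" for i by (simp add: q_def coeff_sum)
  have rq: "reflect_poly q = q"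
    using m_pos by (intro reflect_poly_eqI[of "m - 1"]) (auto simp: cq)
  have "fps_of_poly q = (\<Sum>i<m. fps_X ^ i)"
    by (simp add: q_def fps_of_poly_sum fps_of_poly_monom')
  then show ?thesis unfolding eq
    by (intro exI[of _ "q * p"]) (simp add: fps_of_poly_mult p reflect_poly_mult rp rq)
qed

end

unbundle vec_syntax

section \<open>Integral rows from the codenominator\<close>

definition real_row :: "int ^ 'n \<Rightarrow> real ^ 'n" where
  "real_row a = (\<chi> j. of_int (a $ j))"

lemma ineq_set_inner: "ineq_set (a, b) = {x. real_row a \<bullet> x \<le> of_int b}"
  by (simp add: ineq_set_def real_row_def inner_vec_def)

lemma mem_dilate_pos: "0 < k \<Longrightarrow> x \<in> dilate k S \<longleftrightarrow> (1 / k) *\<^sub>R x \<in> S"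
  by (force simp: dilate_def image_iff)

lemma dilate_dilate: "dilate k (dilate l S) = dilate (k * l) S"
  by (simp add: dilate_def image_image)

text \<open>
  The point \<open>0\<close> satisfies every row, so \<open>b \<ge> 0\<close>. If \<open>b = 0\<close>, then \<open>a \<noteq> 0\<close> by the gcd condition, and a small
  multiple of \<open>a\<close>, although in \<open>P\<close>, violates the row.
\<close>

lemma halfspace_rhs_pos:
  fixes P :: "(real ^ 'n) set"
  assumes H: "halfspace_description H P" and P: "0 \<in> interior P" and ab: "(a, b) \<in> H"
  shows "0 < b"
proof -
  have sub: "P \<subseteq> ineq_set (a, b)" using H ab by (auto simp: halfspace_description_def)
  obtain e where e: "0 < e" "cball 0 e \<subseteq> P" using P by (meson mem_interior_cball)
  then have "0 \<in> P" by auto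
  then have b0: "0 \<le> b" using sub by (auto simp: ineq_set_inner)
  have "b \<noteq> 0"
  proof
    assume b: "b = 0"
    have "a \<noteq> 0"
    proof
      assume "a = 0"
      then have "insert b (range (($) a)) = {0}" using b by auto
      moreover have "Gcd (insert b (range (($) a))) = 1"
        using H ab by (auto simp only: halfspace_description_def split: prod.splits)
      ultimately have "Gcd {0 :: int} = 1" by (simp only:)
      then show False by simp
    qed
    then obtain j where "a $ j \<noteq> 0" by (auto simp: vec_eq_iff)
    then have "real_row a \<noteq> 0" by (auto simp: real_row_def vec_eq_iff)
    then have k: "0 < e / norm (real_row a)" and "(e / norm (real_row a)) *\<^sub>R real_row a \<in> cball 0 e"
      using e by auto
    then have "(e / norm (real_row a)) *\<^sub>R real_row a \<in> ineq_set (a, b)" using e(2) sub by blast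
    then have "e / norm (real_row a) * (real_row a \<bullet> real_row a) \<le> 0"
      unfolding ineq_set_inner b by simp
    moreover have "0 < e / norm (real_row a) * (real_row a \<bullet> real_row a)"
      using k \<open>real_row a \<noteq> 0\<close> by (intro mult_pos_pos) simp_all
    ultimately show False by linarith
  qed
  with b0 show ?thesis by simp
qed

text \<open>
  Scaling the row \<open>(a, b)\<close> by the integer \<open>r/b\<close> makes all right-hand sides equal to \<open>r\<close>. For \<open>t = 0\<close> the
  equivalence says that the recession cone of \<open>P\<close> is trivial, which is where boundedness enters.
\<close>

lemma codenominator_integral_rows:
  fixes P :: "(real ^ 'n) set"
  assumes bd: "bounded P" and r: "has_codenominator P r" and P: "0 \<in> interior P"
  obtains R where "0 < r" "finite R"
    "\<And>t x. 0 \<le> t \<Longrightarrow> x \<in> dilate (t / real r) P \<longleftrightarrow> (\<forall>c\<in>R. real_row c \<bullet> x \<le> t)"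
proof -
  obtain H where H: "halfspace_description H P" and rL: "int r = Lcm {b \<in> snd ` H. b \<noteq> 0}"
    using r by (auto simp: has_codenominator_def)
  have fin: "finite H" and PH: "P = (\<Inter>h\<in>H. ineq_set h)"
    using H by (auto simp: halfspace_description_def)
  have bpos: "0 < b" if "(a, b) \<in> H" for a b using halfspace_rhs_pos[OF H P that] .
  have "finite {b \<in> snd ` H. b \<noteq> 0}" using fin by auto
  then have "int r \<noteq> 0" unfolding rL by (simp add: Lcm_0_iff)
  then have r0: "0 < r" by simp
  have dvd: "b dvd int r" if "(a, b) \<in> H" for a b
    unfolding rL using that bpos[OF that] by (intro dvd_Lcm) force
  define scale where "scale = (\<lambda>(a :: int ^ 'n, b). (\<chi> j. (int r div b) * a $ j) :: int ^ 'n)"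
  have scale: "real_row (scale (a, b)) \<bullet> x = real r / of_int b * (real_row a \<bullet> x)"
    if "(a, b) \<in> H" for a b x
  proof -
    have "of_int (int r div b) = real r / of_int b"
      using dvd[OF that] by (simp add: real_of_int_div)
    then show ?thesis
      by (simp add: scale_def real_row_def inner_vec_def sum_distrib_left mult.assoc)
  qed
  have pos: "x \<in> dilate (t / real r) P \<longleftrightarrow> (\<forall>c\<in>scale ` H. real_row c \<bullet> x \<le> t)" if t: "0 < t" for t x
  proof -
    have "(1 / (t / real r)) *\<^sub>R x \<in> ineq_set (a, b) \<longleftrightarrow> real_row (scale (a, b)) \<bullet> x \<le> t"
      if ab: "(a, b) \<in> H" for a b
      using t r0 bpos[OF ab] by (simp add: ineq_set_inner scale[OF ab] field_simps)
    then show ?thesis using t r0 by (subst mem_dilate_pos) (auto simp: PH)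
  qed
  have zero: "x \<in> dilate (0 / real r) P \<longleftrightarrow> (\<forall>c\<in>scale ` H. real_row c \<bullet> x \<le> 0)" for x
  proof
    assume "x \<in> dilate (0 / real r) P"
    then show "\<forall>c\<in>scale ` H. real_row c \<bullet> x \<le> 0" by (auto simp: dilate_def)
  next
    assume le: "\<forall>c\<in>scale ` H. real_row c \<bullet> x \<le> 0"
    obtain K where K: "\<And>y. y \<in> P \<Longrightarrow> norm y \<le> K" using bd by (auto simp: bounded_iff)
    have "x = 0"
    proof (rule ccontr)
      assume "x \<noteq> 0"
      have K0: "0 \<le> K" using K[of 0] P interior_subset by fastforce
      define s where "s = (K + 1) / norm x"
      have s: "0 \<le> s" "norm (s *\<^sub>R x) = K + 1" using K0 \<open>x \<noteq> 0\<close> by (auto simp: s_def)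
      have "\<forall>c\<in>scale ` H. real_row c \<bullet> (s *\<^sub>R x) \<le> real r"
      proof
        fix c assume "c \<in> scale ` H"
        then have "real_row c \<bullet> x \<le> 0" using le by blast
        then have "s * (real_row c \<bullet> x) \<le> 0" using s by (simp add: mult_nonneg_nonpos)
        then show "real_row c \<bullet> (s *\<^sub>R x) \<le> real r" by simp
      qed
      then have "s *\<^sub>R x \<in> dilate (real r / real r) P" using pos[of "real r"] r0 by simp
      then have "s *\<^sub>R x \<in> P" using r0 by (simp add: dilate_def)
      from K[OF this] s show False by simp
    qed
    moreover have "0 \<in> P" using P interior_subset by blast
    ultimately show "x \<in> dilate (0 / real r) P" by (force simp: dilate_def)
  qed
  show thesis
  proof (rule that[of "scale ` H"])
    show "x \<in> dilate (t / real r) P \<longleftrightarrow> (\<forall>c\<in>scale ` H. real_row c \<bullet> x \<le> t)" if "0 \<le> t" for t x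
      using pos[of t x] zero[of x] that by (cases "t = 0") auto
  qed (use r0 fin in auto)
qed

lemma real_row_inner_int:
  assumes "x \<in> int_points"
  shows "real_row c \<bullet> x \<in> \<int>"
proof -
  have "x $ i \<in> \<int>" for i
    using assms by (force simp: int_points_def Basis_vec_def inner_axis)
  then show ?thesis unfolding inner_vec_def real_row_def by (intro Ints_sum) simp
qed

text \<open>
  The gauge is the maximum of \<open>0\<close> and of the integers \<open>real_row c \<bullet> x\<close>.
\<close>

lemma integral_gauge_exists:
  fixes x :: "real ^ 'n"
  assumes "finite R" and "x \<in> int_points"
  shows "\<exists>k::nat. \<forall>t\<ge>0. (\<forall>c\<in>R. real_row c \<bullet> x \<le> t) \<longleftrightarrow> real k \<le> t"
proof -
  define f where "f c = \<lfloor>real_row c \<bullet> x\<rfloor>" for c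
  have f: "of_int (f c) = real_row c \<bullet> x" for c
    using real_row_inner_int[OF assms(2)] by (simp add: f_def)
  define M where "M = Max (insert 0 (f ` R))"
  have "(\<forall>c\<in>R. real_row c \<bullet> x \<le> t) \<longleftrightarrow> real (nat M) \<le> t" if "0 \<le> t" for t
  proof -
    have "0 \<le> M" unfolding M_def using assms(1) by (intro Max_ge) auto
    then have "real (nat M) \<le> t \<longleftrightarrow> M \<le> \<lfloor>t\<rfloor>" by (simp add: le_floor_iff)
    also have "\<dots> \<longleftrightarrow> (\<forall>c\<in>R. f c \<le> \<lfloor>t\<rfloor>)" unfolding M_def using assms(1) that by simp
    also have "\<dots> \<longleftrightarrow> (\<forall>c\<in>R. real_row c \<bullet> x \<le> t)" by (simp add: le_floor_iff f)
    finally show ?thesis by simp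
  qed
  then show ?thesis by blast
qed

section \<open>The Gorenstein cone\<close>

lemma int_points_Pair: "(t, x) \<in> int_points \<longleftrightarrow> (t::real) \<in> \<int> \<and> x \<in> int_points"
  by (auto simp: int_points_def Basis_prod_def ball_Un)

lemma rat_points_Pair: "(t, x) \<in> rat_points \<longleftrightarrow> (t::real) \<in> \<rat> \<and> x \<in> rat_points"
  by (auto simp: rat_points_def Basis_prod_def ball_Un)

lemma mem_homog_dilate:
  assumes "convex P" "P \<noteq> {}"
  shows "(t, x) \<in> homog (dilate k P) \<longleftrightarrow> 0 \<le> t \<and> x \<in> dilate (t * k) P"
proof -
  have "convex ({1::real} \<times> dilate k P)"
    using assms by (intro convex_Times) (auto simp: dilate_def convex_scaling)
  moreover have "{1::real} \<times> dilate k P \<noteq> {}" using assms by (auto simp: dilate_def)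
  ultimately have "homog (dilate k P) = (\<Union>x\<in>{1} \<times> dilate k P. \<Union>c\<in>{0..}. {c *\<^sub>R x})"
    by (simp add: homog_def convex_cone_hull_convex_hull_nonempty hull_same)
  then show ?thesis by (auto simp: dilate_def)
qed

lemma rational_cone_homog:
  fixes P :: "'a::euclidean_space set"
  assumes P: "rational_polytope P" and k: "k \<in> \<rat>"
  shows "rational_cone (homog (dilate k P))"
proof -
  obtain W where W: "finite W" "W \<subseteq> rat_points" "P = convex hull W"
    using P by (auto simp: rational_polytope_def)
  let ?T = "{1::real} \<times> (*\<^sub>R) k ` W"
  have "homog (dilate k P) = convex_cone hull (convex hull ?T)"
    by (simp add: homog_def dilate_def W convex_hull_Times convex_hull_scaling)
  also have "\<dots> = convex_cone hull ?T"
    by (intro antisym hull_minimal convex_hull_subset_convex_cone_hull convex_cone_convex_cone_hull hull_mono hull_subset)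
  finally have "homog (dilate k P) = convex_cone hull ?T" .
  moreover have "?T \<subseteq> rat_points"
    using W k by (auto simp: rat_points_Pair) (auto simp: rat_points_def)
  moreover have "finite ?T" using W(1) by simp
  ultimately show ?thesis unfolding rational_cone_def by (intro exI[of _ ?T] conjI)
qed

text \<open>
  For integers, \<open>real_row c \<bullet> x < t\<close> is the same as \<open>real_row c \<bullet> x \<le> t - 1\<close>, so subtracting \<open>(1, 0)\<close> maps
  the lattice points of the interior onto those of the cone.
\<close>

lemma gorenstein_cone_of_rows:
  fixes R :: "(int ^ 'n) set"
  assumes R: "finite R" and C: "rational_cone C"
    and mem: "\<And>t x. (t, x) \<in> C \<longleftrightarrow> 0 \<le> t \<and> (\<forall>c\<in>R. real_row c \<bullet> x \<le> t)"
    and zero: "\<And>x. (\<And>c. c \<in> R \<Longrightarrow> real_row c \<bullet> x \<le> 0) \<Longrightarrow> x = 0"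
  shows "gorenstein_cone C" "gorenstein_point C (1, 0)"
proof -
  have int: "interior C = {(t, x). 0 < t \<and> (\<forall>c\<in>R. real_row c \<bullet> x < t)}" (is "_ = ?I")
  proof (rule interior_unique)
    show "?I \<subseteq> C" using less_imp_le by (fastforce simp: mem)
    have "?I = {p. 0 < fst p} \<inter> (\<Inter>c\<in>R. {p. real_row c \<bullet> snd p < fst p})" by auto
    also have "open \<dots>" using R
      by (intro open_Int open_INT ballI open_Collect_less continuous_intros)
    finally show "open ?I" .
    show "T \<subseteq> ?I" if T: "T \<subseteq> C" "open T" for T
    proof (rule subrelI, simp, intro conjI ballI)
      fix t x assume "(t, x) \<in> T"
      then obtain e where e: "0 < e" "cball (t, x) e \<subseteq> T" using T(2) by (meson open_contains_cball)
      have "(t - e, x) \<in> cball (t, x) e" using e(1) by (simp add: dist_Pair_Pair dist_real_def)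
      then have "(t - e, x) \<in> C" using e T(1) by blast
      then have *: "0 \<le> t - e" "\<And>c. c \<in> R \<Longrightarrow> real_row c \<bullet> x \<le> t - e" by (auto simp: mem)
      then show "0 < t" using e by linarith
      show "real_row c \<bullet> x < t" if "c \<in> R" for c using *(2)[OF that] e by linarith
    qed
  qed
  have "interior C \<inter> int_points = (+) (1, 0) ` (C \<inter> int_points)"
  proof (rule set_eqI)
    fix p :: "real \<times> (real ^ 'n)"
    obtain t x where p: "p = (t, x)" by force
    have img: "p \<in> (+) (1, 0) ` (C \<inter> int_points) \<longleftrightarrow> (t - 1, x) \<in> C \<inter> int_points"
      unfolding p by (force simp: image_iff)
    have strict: "s < t \<longleftrightarrow> s \<le> t - 1" if "s \<in> \<int>" "t \<in> \<int>" for s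
      using that by (auto elim!: Ints_cases)
    have t1: "t - 1 \<in> \<int> \<longleftrightarrow> t \<in> \<int>" by (metis Ints_1 Ints_add Ints_diff diff_add_cancel)
    show "p \<in> interior C \<inter> int_points \<longleftrightarrow> p \<in> (+) (1, 0) ` (C \<inter> int_points)"
      unfolding img unfolding p int Int_iff int_points_Pair t1 mem
      using strict[of 0] strict[OF real_row_inner_int[of x]] by auto
  qed
  moreover have "(0 :: real ^ 'n) \<in> int_points" by (simp add: int_points_def)
  then have "(1, 0) \<in> C \<inter> int_points" by (simp add: mem int_points_Pair)
  ultimately show gp: "gorenstein_point C (1, 0)" by (simp add: gorenstein_point_def)
  have "pointed_cone C"
    unfolding pointed_cone_def
  proof (rule set_eqI)
    fix p :: "real \<times> (real ^ 'n)"
    obtain t x where p: "p = (t, x)" by force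
    have "p \<in> uminus ` C \<longleftrightarrow> (- t, - x) \<in> C" unfolding p by (force simp: image_iff)
    then show "p \<in> C \<inter> uminus ` C \<longleftrightarrow> p \<in> {0}"
      using zero[of x] by (auto simp: p mem zero_prod_def)
  qed
  moreover have "dim C = DIM(real \<times> (real ^ 'n))"
  proof -
    have "(1, 0) \<in> interior C" by (simp add: int)
    then have "interior C \<noteq> {}" by blast
    then have "\<not> dim C < DIM(real \<times> (real ^ 'n))" using empty_interior_lowdim by blast
    then show ?thesis using dim_subset_UNIV[of C] by linarith
  qed
  ultimately show "gorenstein_cone C" using C gp by (auto simp: gorenstein_cone_def)
qed

section \<open>Gorenstein property and palindromicity\<close>

theorem corollary28:
  fixes P :: "(real ^ 'n) set" and r :: nat
  assumes "rational_d_polytope P"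
    and "has_codenominator P r"
    and "0 \<in> interior P"
  shows "rational_gorenstein (real r) P \<and>
         rational_gorenstein_point (real r) P (1, 0) \<and>
         (\<forall>m::nat. m > 0 \<longrightarrow> lattice_polytope (dilate (real m / real r) P) \<longrightarrow>
            (\<exists>h :: int poly. fps_of_poly h = hstarQ P r m \<and> palindromic h))"
proof -
  have rat: "rational_polytope P" using assms(1) by (simp add: rational_d_polytope_def)
  then have cvx: "convex P" "bounded P"
    by (auto simp: rational_polytope_def finite_imp_bounded_convex_hull)
  have P0: "0 \<in> P" using assms(3) interior_subset by blast
  obtain R where r: "0 < r" and R: "finite R"
    and dil: "\<And>t x. 0 \<le> t \<Longrightarrow> x \<in> dilate (t / real r) P \<longleftrightarrow> (\<forall>c\<in>R. real_row c \<bullet> x \<le> t)"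
    using codenominator_integral_rows[OF cvx(2) assms(2,3)] by metis
  let ?C = "homog (dilate (1 / real r) P)"
  have rows: "(t, x) \<in> ?C \<longleftrightarrow> 0 \<le> t \<and> (\<forall>c\<in>R. real_row c \<bullet> x \<le> t)" for t x
    using mem_homog_dilate[OF cvx(1), of t x "1 / real r"] P0 dil[of t x] by auto
  have zero: "x = 0" if "\<And>c. c \<in> R \<Longrightarrow> real_row c \<bullet> x \<le> 0" for x
    using dil[of 0 x] that by (auto simp: dilate_def)
  note gor = gorenstein_cone_of_rows[OF R rational_cone_homog[OF rat] rows zero]
  have "\<exists>h :: int poly. fps_of_poly h = hstarQ P r m \<and> palindromic h"
    if m: "0 < m" and lat: "lattice_polytope (dilate (real m / real r) P)" for m :: nat
  proof -
    obtain V where V: "finite V" "V \<subseteq> int_points" "dilate (real m / real r) P = convex hull V"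
      using lat by (auto simp: lattice_polytope_def)
    obtain N :: "real ^ 'n \<Rightarrow> nat" where N: "\<And>x t. x \<in> int_points \<Longrightarrow> 0 \<le> t \<Longrightarrow>
        (\<forall>c\<in>R. real_row c \<bullet> x \<le> t) \<longleftrightarrow> real (N x) \<le> t"
      using integral_gauge_exists[OF R] by metis
    interpret lattice_gauge V m N
    proof
      show "0 \<in> interior (convex hull V)"
        unfolding V(3)[symmetric] dilate_def using m r assms(3)
        by (subst interior_injective_linear_image) (auto simp: inj_on_def image_iff intro!: bexI[of _ 0])
      show "x \<in> dilate (t / real m) (convex hull V) \<longleftrightarrow> real (N x) \<le> t"
        if "x \<in> int_points" "0 \<le> t" for x t
        using dil[OF that(2), of x] N[OF that] m by (simp add: V(3)[symmetric] dilate_dilate)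
    qed (use V m in auto)
    have "fps_nth (EhrQ P r) n = int (card {x\<in>int_points. N x \<le> n})" for n
    proof (cases "n = 0")
      case False
      have "dilate (real n / real r) P \<inter> int_points = {x\<in>int_points. N x \<le> n}"
        using dil[of "real n"] N[of _ "real n"] by auto
      then show ?thesis using False by (simp add: EhrQ_def ehrQ_def)
    qed (simp add: EhrQ_def gauge_zero)
    from hstar_palindromic[OF this] show ?thesis by (simp add: hstarQ_def palindromic_def)
  qed
  moreover have "rational_gorenstein (real r) P"
    unfolding rational_gorenstein_def using assms(1) gor(1) by simp
  moreover have "rational_gorenstein_point (real r) P (1, 0)"
    unfolding rational_gorenstein_point_def using gor(2) by simp
  ultimately show ?thesis by blast
qed

end
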